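(* Let $n\ge 1$ and $1\le r\le s$ be integers, and let $K=\{k_1,\dots,k_r\}$ and $L=\{\ell_1,\dots,\ell_s\}$ be sets of nonnegative integers with $|K|=r$ and $|L|=s$. Assume that $k_i>s-r$ for every $i\in\{1,\dots,r\}$. Let $\mathcal{F}\subseteq\bigcup_{k\in K}\binom{[n]}{k}$ be an $L$-intersecting family. Then $$|\mathcal{F}|+\sum_{j=s-r+1}^{s}|\mathcal{N}_j(\mathcal{F})|\le N(n,s,r).$$ Equivalently, $$|\mathcal{F}|\le\sum_{j=s-r+1}^{s}|\partial_j\mathcal{F}|.$$
   Context: Here $[n]=\{1,\dots,n\}$ and $\binom{[n]}{t}$ is the set of all $t$-element subsets of $[n]$ (empty if $t>n$). A family $\mathcal{F}$ of subsets of $[n]$ is $L$-intersecting if $|A\cap B|\in L$ for all distinct $A,B\in\mathcal{F}$. For an integer $t\ge 0$, the $t$-shadow of $\mathcal{F}$ is $\partial_t\mathcal{F}=\{T\in\binom{[n]}{t}:\exists F\in\mathcal{F}\text{ with }T\subseteq F\}$, and the $t$-non-shadow is $\mathcal{N}_t(\mathcal{F})=\binom{[n]}{t}\setminus\partial_t\mathcal{F}$ (both are empty when $t>n$). For $1\le r\le s$, $N(n,s,r)=\binom{n}{s}+\binom{n}{s-1}+\cdots+\binom{n}{s-r+1}$. *)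

theory Defs
  imports Main "HOL-Library.Ramsey"
begin

text \<open>The set $[n]$ is \<open>{1..n}\<close>, and the set of its \<open>t\<close>-element subsets is
  \<open>nsets {1..n} t\<close>, from \<open>HOL-Library.Ramsey\<close>.\<close>

definition L_intersecting :: "nat set \<Rightarrow> nat set set \<Rightarrow> bool" where
  "L_intersecting L F \<longleftrightarrow> (\<forall>A\<in>F. \<forall>B\<in>F. A \<noteq> B \<longrightarrow> card (A \<inter> B) \<in> L)"

definition shadow :: "nat \<Rightarrow> nat \<Rightarrow> nat set set \<Rightarrow> nat set set" where
  "shadow n t F = {T \<in> nsets {1..n} t. \<exists>A\<in>F. T \<subseteq> A}"

definition non_shadow :: "nat \<Rightarrow> nat \<Rightarrow> nat set set \<Rightarrow> nat set set" where
  "non_shadow n t F = nsets {1..n} t - shadow n t F"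

text \<open>Meant for \<open>1 \<le> r \<le> s\<close>, where the subtraction \<open>s - i\<close> does not truncate.\<close>

definition binom_sum :: "nat \<Rightarrow> nat \<Rightarrow> nat \<Rightarrow> nat" where
  "binom_sum n s r = (\<Sum>i<r. n choose (s - i))"

end

theory Submission
  imports Defs Complex_Main "HOL-Library.Function_Algebras"
begin

text \<open>Polynomial method of Alon, Babai and Suzuki. In the space of real functions on sets spanned
  by the monomials \<open>X \<mapsto> [T \<subseteq> X]\<close> with \<open>T \<subseteq> [n]\<close>, \<open>|T| \<le> s\<close>, consider three kinds of functions,
  each attached to a subset of \<open>[n]\<close>:
  for \<open>A \<in> F\<close> the product of \<open>|A \<inter> X| - l\<close> over \<open>l \<in> L\<close>, \<open>l < |A|\<close>;
  for \<open>|I| \<le> s - r\<close> the monomial of \<open>I\<close> times the product of \<open>|X| - k\<close> over \<open>k \<in> K\<close>;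
  for a non-shadow \<open>T\<close> of size in \<open>(s - r, s]\<close> the monomial of \<open>T\<close> itself.
  Functions of the last two kinds vanish on \<open>F\<close>, and those of the last kind vanish on the sets of
  size at most \<open>s - r\<close>. Hence the matrix of values of these functions at the sets they are attached
  to is triangular with nonzero diagonal, so they are independent, and their number is at most the
  number of monomials.\<close>

interpretation real_fun: vector_space "\<lambda>(c::real) (f :: 'a \<Rightarrow> real) x. c * f x"
  by unfold_locales (auto simp: fun_eq_iff algebra_simps)

lemma sum_fun_apply: "(\<Sum>i\<in>I. f i) x = (\<Sum>i\<in>I. f i x)"
  by (induction I rule: infinite_finite_induct) auto

text \<open>Evaluate a vanishing linear combination at \<open>a\<close>: terms with
  \<open>rank b < rank a\<close> have coefficient 0 by induction, all other terms with
  \<open>b \<noteq> a\<close> vanish at \<open>a\<close>, and the diagonal entry is nonzero. Ties in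
  \<open>rank\<close> are harmless, as both off-diagonal entries are then 0.\<close>

lemma triangular_card_le:
  fixes v :: "'a \<Rightarrow> 'a \<Rightarrow> real" and rank :: "'a \<Rightarrow> nat"
  assumes "finite P" "finite B"
    and diag: "\<And>a. a \<in> P \<Longrightarrow> v a a \<noteq> 0"
    and upper: "\<And>a b. \<lbrakk>a \<in> P; b \<in> P; a \<noteq> b; rank b \<le> rank a\<rbrakk> \<Longrightarrow> v a b = 0"
    and span: "\<And>a. a \<in> P \<Longrightarrow> v a \<in> real_fun.span B"
  shows "card P \<le> card B"
proof -
  have inj: "inj_on v P"
  proof (rule inj_onI, rule ccontr)
    fix a b assume ab: "a \<in> P" "b \<in> P" "v a = v b" "a \<noteq> b"
    then show False
      using upper[of a b] upper[of b a] diag[of a] diag[of b] by (metis nat_le_linear)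
  qed
  have "real_fun.independent (v ` P)"
  proof (rule real_fun.independent_if_scalars_zero)
    show "finite (v ` P)" using \<open>finite P\<close> by simp
    fix c w assume zero: "(\<Sum>w\<in>v ` P. (\<lambda>x. c w * w x)) = 0" and w: "w \<in> v ` P"
    have eq: "(\<Sum>a\<in>P. c (v a) * v a x) = 0" for x
      using fun_cong[OF zero, of x] by (simp add: sum_fun_apply sum.reindex[OF inj])
    have "c (v a) = 0" if "a \<in> P" for a
      using that
    proof (induction a rule: measure_induct_rule[of rank])
      case (less a)
      have "(\<Sum>b\<in>P. c (v b) * v b a) = (\<Sum>b\<in>P. if b = a then c (v a) * v a a else 0)"
        using less.IH upper[OF _ less.prems] by (intro sum.cong refl) (force simp: not_less[symmetric])
      then have "c (v a) * v a a = 0"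
        using eq[of a] less.prems \<open>finite P\<close> by simp
      then show ?case using diag less.prems by simp
    qed
    then show "c w = 0" using w by auto
  qed
  then have "card (v ` P) \<le> card B"
    using real_fun.independent_span_bound[OF \<open>finite B\<close>, of "v ` P"] span by blast
  then show ?thesis by (simp add: card_image[OF inj])
qed

definition monomial :: "'a set \<Rightarrow> 'a set \<Rightarrow> real" where
  "monomial T X = of_bool (T \<subseteq> X)"

definition monomials :: "'a set \<Rightarrow> nat \<Rightarrow> ('a set \<Rightarrow> real) set" where
  "monomials V d = monomial ` {T. T \<subseteq> V \<and> card T \<le> d}"

lemma monomial_in_monomials: "T \<subseteq> V \<Longrightarrow> card T \<le> d \<Longrightarrow> monomial T \<in> monomials V d"
  by (auto simp: monomials_def)

text \<open>Write |A \<inter> X| as the sum of [a \<in> X] over a \<in> A and absorb each indicator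
  into the monomial. If a \<in> T nothing changes, so a linear factor raises the degree by at most
  1.\<close>

lemma card_inter_times_monomial:
  assumes "finite A"
  shows "(\<lambda>X. real (card (A \<inter> X)) * monomial T X) = (\<Sum>a\<in>A. monomial (insert a T))"
proof
  fix X
  have "real (card (A \<inter> X)) = (\<Sum>a\<in>A. of_bool (a \<in> X))"
    using assms by (simp add: of_bool_def sum.If_cases Int_def)
  then show "real (card (A \<inter> X)) * monomial T X = (\<Sum>a\<in>A. monomial (insert a T)) X"
    by (simp add: sum_fun_apply sum_distrib_right monomial_def of_bool_conj)
qed

lemma span_monomials_Suc:
  assumes "finite A" "A \<subseteq> V" "f \<in> real_fun.span (monomials V d)"
  shows "(\<lambda>X. f X * (real (card (A \<inter> X)) - c)) \<in> real_fun.span (monomials V (Suc d))"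
  using assms(3)
proof (induction rule: real_fun.span_induct_alt)
  case base
  then show ?case using real_fun.span_zero by (simp add: zero_fun_def)
next
  case (step b f g)
  then obtain T where T: "f = monomial T" "T \<subseteq> V" "card T \<le> d"
    by (auto simp: monomials_def)
  have "(\<lambda>X. real (card (A \<inter> X)) * f X) \<in> real_fun.span (monomials V (Suc d))"
    unfolding T(1) card_inter_times_monomial[OF \<open>finite A\<close>]
    using T(2,3) \<open>A \<subseteq> V\<close>
    by (intro real_fun.span_sum real_fun.span_base monomial_in_monomials)
       (auto intro: le_trans[OF card_insert_le_m1])
  moreover have "f \<in> real_fun.span (monomials V (Suc d))"
    using T by (auto intro!: real_fun.span_base monomial_in_monomials)
  ultimately have "(\<lambda>X. b * ((\<lambda>X. real (card (A \<inter> X)) * f X) - (\<lambda>X. c * f X)) X)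
      + (\<lambda>X. g X * (real (card (A \<inter> X)) - c)) \<in> real_fun.span (monomials V (Suc d))"
    using step by (intro real_fun.span_add real_fun.span_scale real_fun.span_diff)
  then show ?case
    by (rule back_subst[of "\<lambda>h. h \<in> _"]) (auto simp: fun_eq_iff algebra_simps)
qed

text \<open>Applied with \<open>T = {}\<close> to the functions of members of \<open>F\<close>, and
  with \<open>A = V\<close>, \<open>M = K\<close> to those of the small sets.\<close>

lemma span_monomials_prod:
  assumes "finite A" "A \<subseteq> V" "finite M" "T \<subseteq> V"
  shows "(\<lambda>X. monomial T X * (\<Prod>l\<in>M. real (card (A \<inter> X)) - real l))
    \<in> real_fun.span (monomials V (card T + card M))"
  using assms(3)
proof (induction M)
  case empty
  then show ?case using assms(4) by (auto intro: real_fun.span_base monomial_in_monomials)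
next
  case (insert l M)
  then show ?case
    using span_monomials_Suc[OF assms(1,2) insert.IH, of "real l"]
    by (simp add: mult_ac)
qed

lemma card_subsets_bounded:
  assumes "finite V"
  shows "card {T. T \<subseteq> V \<and> card T \<le> d} = (\<Sum>i\<le>d. card V choose i)"
proof -
  have "{T. T \<subseteq> V \<and> card T \<le> d} = (\<Union>i\<le>d. {T. T \<subseteq> V \<and> card T = i})" by auto
  also have "card \<dots> = (\<Sum>i\<le>d. card {T. T \<subseteq> V \<and> card T = i})"
    using assms by (intro card_UN_disjoint) auto
  finally show ?thesis using n_subsets[OF assms] by simp
qed

theorem theorem2:
  fixes n r s :: nat and K L :: "nat set" and F :: "nat set set"
  assumes "n \<ge> 1" and "1 \<le> r" and "r \<le> s"
    and "card K = r" and "card L = s"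
    and "\<forall>k\<in>K. k > s - r"
    and "F \<subseteq> (\<Union>k\<in>K. nsets {1..n} k)"
    and "L_intersecting L F"
  shows "card F + (\<Sum>j=s-r+1..s. card (non_shadow n j F)) \<le> binom_sum n s r
    \<and> card F \<le> (\<Sum>j=s-r+1..s. card (shadow n j F))"
proof -
  define V where "V = {1..n}"
  define S where "S = {I. I \<subseteq> V \<and> card I \<le> s - r}"
  define N where "N = (\<Union>j\<in>{s-r+1..s}. non_shadow n j F)"
  \<comment> \<open>Restricting to \<open>l < card A\<close> keeps the value at \<open>A\<close>
    itself nonzero.\<close>
  define v where "v A X = (if A \<in> F then \<Prod>l | l \<in> L \<and> l < card A. real (card (A \<inter> X)) - real l
    else if card A \<le> s - r then monomial A X * (\<Prod>k\<in>K. real (card (V \<inter> X)) - real k)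
    else monomial A X)" for A X :: "nat set"
  \<comment> \<open>Members of \<open>F\<close> have at most \<open>n\<close> elements, so the shift
    by \<open>Suc n\<close> ranks every other set after all of them.\<close>
  define rank where "rank A = (if A \<in> F then card A else Suc n + card A)" for A :: "nat set"
  have V: "finite V" "card V = n" by (auto simp: V_def)
  have fin: "finite K" "finite L" using assms by (auto intro: card_ge_0_finite)
  have F: "A \<subseteq> V" "card A \<in> K" "finite A" "card A > s - r" "card A \<le> n" if A: "A \<in> F" for A
  proof -
    obtain k where "k \<in> K" "A \<in> nsets V k" using assms(7) A unfolding V_def by blast
    then show "A \<subseteq> V" "card A \<in> K" "finite A" "card A > s - r" "card A \<le> n"
      using assms(6) V card_mono[of V A] by (auto simp: nsets_def)
  qed
  have S: "A \<subseteq> V" "finite A" "card A \<le> s - r" "A \<notin> F" if "A \<in> S" for A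
    using that F(4)[of A] V by (auto simp: S_def intro: finite_subset)
  have N: "A \<subseteq> V" "finite A" "s - r < card A" "card A \<le> s" "A \<notin> F"
    "\<And>B. B \<in> F \<Longrightarrow> \<not> A \<subseteq> B" if "A \<in> N" for A
    using that by (auto simp: N_def non_shadow_def shadow_def nsets_def V_def)
  have finP: "finite F" "finite S" "finite N"
  proof -
    have "F \<subseteq> Pow V" "S \<subseteq> Pow V" "N \<subseteq> Pow V" using F(1) S(1) N(1) by blast+
    then show "finite F" "finite S" "finite N"
      using V by (meson finite_Pow_iff finite_subset)+
  qed
  have le: "card (F \<union> S \<union> N) \<le> card (monomials V s)"
  proof (rule triangular_card_le[of _ _ v rank])
    show "finite (F \<union> S \<union> N)" using finP by simp
    show "finite (monomials V s)" using V by (simp add: monomials_def)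
    show "v A A \<noteq> 0" if "A \<in> F \<union> S \<union> N" for A
    proof (cases "A \<in> F")
      case True
      then show ?thesis using fin by (auto simp: v_def)
    next
      case False
      then have "V \<inter> A = A" using that S(1) N(1) by blast
      \<comment> \<open>For \<open>A \<in> S\<close> no factor is zero, because |A| \<le> s - r < k
        for all k \<in> K.\<close>
      then show ?thesis
        using False that S N fin assms(6) by (auto simp: v_def monomial_def)
    qed
    show "v A B = 0"
      if AB: "A \<in> F \<union> S \<union> N" "B \<in> F \<union> S \<union> N" "A \<noteq> B" "rank B \<le> rank A" for A B
    proof (cases "A \<in> F")
      case True
      then have B: "B \<in> F" "card B \<le> card A"
        using AB(4) F(5)[of A] by (auto simp: rank_def split: if_splits)
      have "card (A \<inter> B) \<in> L"
        using assms(8) True B AB(3) by (auto simp: L_intersecting_def)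
      \<comment> \<open>Strictness ensures that the factor for l = |A \<inter> B| survived the
        restriction to \<open>l < card A\<close>.\<close>
      moreover have "card (A \<inter> B) < card A"
      proof -
        have "\<not> A \<subseteq> B" using B(2) AB(3) F(3)[OF B(1)] card_seteq by blast
        then show ?thesis using F(3)[OF True] by (intro psubset_card_mono) auto
      qed
      ultimately show ?thesis using True fin by (auto simp: v_def)
    next
      case False
      show ?thesis
      proof (cases "B \<in> F")
        case True
        then have "V \<inter> B = B" using F(1) by blast
        \<comment> \<open>If \<open>A\<close> is small, the factor for k = |B| is zero; if
          \<open>A\<close> is a non-shadow, its monomial vanishes at \<open>B\<close>.\<close>
        then show ?thesis
          using True False AB(1) F(2)[OF True] fin N(3)[of A] N(6)[of A B]
          by (auto simp: v_def monomial_def dest: S)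
      next
        case B: False
        then have "card B \<le> card A" using False AB(4) by (simp add: rank_def)
        moreover have "finite B" using AB(2) B S(2) N(2) by blast
        \<comment> \<open>Both kinds of functions outside \<open>F\<close> contain the factor
          \<open>monomial A\<close>, so this suffices.\<close>
        ultimately have "\<not> A \<subseteq> B" using AB(3) card_seteq by blast
        then show ?thesis using False by (simp add: v_def monomial_def)
      qed
    qed
    show "v A \<in> real_fun.span (monomials V s)" if A: "A \<in> F \<union> S \<union> N" for A
    proof -
      have up: "f \<in> real_fun.span (monomials V s)"
        if "f \<in> real_fun.span (monomials V d)" "d \<le> s" for f d
        using that real_fun.span_mono[of "monomials V d" "monomials V s"]
        by (force simp: monomials_def)
      consider "A \<in> F" | "A \<in> S" | "A \<in> N" using A by blast
      then show ?thesis
      proof cases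
        case 1
        have "card {l \<in> L. l < card A} \<le> s"
          using fin assms(5) card_mono[of L "{l \<in> L. l < card A}"] by auto
        then show ?thesis
          using up[OF span_monomials_prod[of A V "{l \<in> L. l < card A}" "{}"]] F[OF 1] fin 1
          by (simp add: v_def[abs_def] monomial_def)
      next
        case 2
        \<comment> \<open>The degree is at most (s - r) + r = s.\<close>
        then show ?thesis
          using up[OF span_monomials_prod[of V V K A]] S[OF 2] fin V assms(3,4)
          by (simp add: v_def[abs_def])
      next
        case 3
        then have "v A = monomial A" using N[OF 3] by (simp add: v_def fun_eq_iff)
        then show ?thesis
          using N[OF 3] by (auto intro!: real_fun.span_base monomial_in_monomials)
      qed
    qed
  qed
  have "card (F \<union> S \<union> N) = card F + card S + card N"
  proof -
    have "F \<inter> S = {}" "(F \<union> S) \<inter> N = {}" using S(3,4) N(3,5) by fastforce+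
    then show ?thesis using finP by (simp add: card_Un_disjoint)
  qed
  moreover have "card S = (\<Sum>i\<le>s - r. n choose i)"
    using card_subsets_bounded[OF V(1)] V(2) by (simp add: S_def)
  moreover have cardN: "card N = (\<Sum>j=s-r+1..s. card (non_shadow n j F))"
    unfolding N_def
    by (intro card_UN_disjoint)
      (auto simp: non_shadow_def nsets_def intro: finite_subset[of _ "Pow {1..n}"])
  moreover have "card (monomials V s) \<le> (\<Sum>i\<le>s. n choose i)"
    using card_image_le[of "{T. T \<subseteq> V \<and> card T \<le> s}" monomial] V card_subsets_bounded[OF V(1), of s]
    by (simp add: monomials_def)
  \<comment> \<open>The first summand is |S|, so it cancels and leaves the top r binomials.\<close>
  moreover have "(\<Sum>i\<le>s. n choose i) = (\<Sum>i\<le>s - r. n choose i) + (\<Sum>j=s-r+1..s. n choose j)"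
    using sum_up_index_split[of "\<lambda>i. n choose i" "s - r" r] assms(3) by simp
  ultimately have main: "card F + card N \<le> (\<Sum>j=s-r+1..s. n choose j)"
    using le by linarith
  have "binom_sum n s r = (\<Sum>j=s-r+1..s. n choose j)"
    unfolding binom_sum_def using assms(2,3)
    by (intro sum.reindex_bij_witness[of _ "\<lambda>j. s - j" "\<lambda>i. s - i"]) auto
  \<comment> \<open>Complementing level by level turns the first bound into the second.\<close>
  moreover have "card (non_shadow n j F) + card (shadow n j F) = n choose j" for j
  proof -
    have "finite (nsets {1..n} j)" "shadow n j F \<subseteq> nsets {1..n} j"
      by (auto simp: shadow_def finite_imp_finite_nsets)
    then show ?thesis
      using card_mono[of "nsets {1..n} j" "shadow n j F"]
      by (simp add: non_shadow_def card_Diff_subset finite_subset card_nsets)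
  qed
  then have "(\<Sum>j=s-r+1..s. n choose j) = card N + (\<Sum>j=s-r+1..s. card (shadow n j F))"
    unfolding cardN sum.distrib[symmetric] by simp
  ultimately show ?thesis using main cardN by linarith
qed

end
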